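(* For every integer $n>2$ there exist a signed group $S$ and a signed group orthogonal design $SOD\big(2^n;\,1_{(2^n)},S\big)$ (i.e. of order $2^n$ and type $(1,1,\dots,1)$ with $2^n$ ones) such that $S$ admits a remrep (real monomial representation) of degree $2^{2^{n-1}-1}$.
   Context: A signed group is a group $S$ together with a distinguished central element of order two, denoted $-1$ (the unit is denoted $1$). Let $\varrho$ be a transversal of $\langle -1\rangle$ in $S$. The signed group ring $\mathbb{R}[S]$ consists of formal sums $\sum_i s_i r_i$ with $s_i\in\varrho$, $r_i\in\mathbb{R}$, where one identifies $(-s)r=s(-r)$ for $s\in\varrho$; addition is termwise and multiplication is by linear extension. Conjugation is $\overline{\sum_i s_i r_i}=\sum_i s_i^{-1} r_i$. A signed group orthogonal design of order $n$ and type $(u_1,\dots,u_k)$ over $S$, denoted $SOD(n;\,u_1,\dots,u_k,S)$, is an $n\times n$ matrix $X$ each of whose entries is either $0$ or of the form $\epsilon x_i$ with $\epsilon\in S$ and $x_1,\dots,x_k$ commuting variables, such that $XX^*=\big(\sum_{i=1}^k u_i x_i^2\big)I_n$, where the $u_i$ are positive integers, $X^*$ is the conjugate transpose (the conjugate of $\epsilon x_i$ being $\epsilon^{-1}x_i$), and matrix operations are over $\mathbb{R}[S]$. The notation $u_{(k)}$ means $u$ repeated $k$ times. Let $SP_m$ denote the group of $m\times m$ monomial matrices with nonzero entries in $\{\pm1\}$, regarded as a signed group with distinguished element $-I_m$. A remrep of degree $m$ of a signed group $S$ is a map $\phi:S\to SP_m$ with $\phi(ab)=\phi(a)\phi(b)$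 for all $a,b\in S$ and $\phi(-1)=-I_m$. *)

theory Defs
  imports
    "HOL-Library.Poly_Mapping"
    "HOL-Algebra.Multiplicative_Group"
    "Jordan_Normal_Form.Matrix"
begin

locale signed_group = group S for S (structure) +
  fixes neg
  assumes neg_closed: "neg \<in> carrier S"
    and neg_central: "\<And>s. s \<in> carrier S \<Longrightarrow> neg \<otimes> s = s \<otimes> neg"
    and neg_order: "ord neg = 2"

definition transversal :: "('a, 'b) monoid_scheme \<Rightarrow> 'a \<Rightarrow> 'a set \<Rightarrow> bool" where
  "transversal S neg T \<longleftrightarrow>
     T \<subseteq> carrier S \<and> (\<forall>s\<in>carrier S. \<exists>!t. t \<in> T \<and> t \<in> {s, neg \<otimes>\<^bsub>S\<^esub> s})"

text \<open>
  A formal sum of terms \<open>s r\<close> with \<open>s\<close> in the transversal \<open>T\<close> is encoded as the finitely supported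
  function sending \<open>s\<close> to its coefficient \<open>r\<close>. The following is the single term \<open>s r\<close> for an
  arbitrary group element \<open>s\<close>; outside \<open>T\<close> it is \<open>(-s) (-r)\<close>.
\<close>

definition sg_term ::
  "('a, 'b) monoid_scheme \<Rightarrow> 'a \<Rightarrow> 'a set \<Rightarrow> 'a \<Rightarrow> 'r::comm_ring_1 \<Rightarrow> 'a \<Rightarrow> 'r" where
  "sg_term S neg T s r =
     (if s \<in> T then (\<lambda>t. if t = s then r else 0)
      else (\<lambda>t. if t = neg \<otimes>\<^bsub>S\<^esub> s then - r else 0))"

definition signed_group_ring ::
  "('a, 'b) monoid_scheme \<Rightarrow> 'a \<Rightarrow> 'a set \<Rightarrow> ('a \<Rightarrow> 'r::comm_ring_1) ring" where
  "signed_group_ring S neg T =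
     \<lparr>carrier = {f. finite {s. f s \<noteq> 0} \<and> {s. f s \<noteq> 0} \<subseteq> T},
      monoid.mult = (\<lambda>f g t. \<Sum>a | f a \<noteq> 0. \<Sum>b | g b \<noteq> 0. sg_term S neg T (a \<otimes>\<^bsub>S\<^esub> b) (f a * g b) t),
      one = sg_term S neg T \<one>\<^bsub>S\<^esub> 1,
      zero = (\<lambda>t. 0),
      add = (\<lambda>f g t. f t + g t)\<rparr>"

definition sg_conj ::
  "('a, 'b) monoid_scheme \<Rightarrow> 'a \<Rightarrow> 'a set \<Rightarrow> ('a \<Rightarrow> 'r::comm_ring_1) \<Rightarrow> 'a \<Rightarrow> 'r" where
  "sg_conj S neg T f = (\<lambda>t. \<Sum>a | f a \<noteq> 0. sg_term S neg T (inv\<^bsub>S\<^esub> a) (f a) t)"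

text \<open>The product of \<^typ>\<open>'a mat\<close> needs a type class, so it cannot be used over a ring record.\<close>

definition mat_mult_over :: "('a, 'b) ring_scheme \<Rightarrow> 'a mat \<Rightarrow> 'a mat \<Rightarrow> 'a mat" where
  "mat_mult_over R A B =
     mat (dim_row A) (dim_col B)
       (\<lambda>(i, j). \<Oplus>\<^bsub>R\<^esub>l\<in>{..<dim_col A}. A $$ (i, l) \<otimes>\<^bsub>R\<^esub> B $$ (l, j))"

definition sg_conj_transpose ::
  "('a, 'b) monoid_scheme \<Rightarrow> 'a \<Rightarrow> 'a set \<Rightarrow> ('a \<Rightarrow> 'r::comm_ring_1) mat \<Rightarrow> ('a \<Rightarrow> 'r) mat" where
  "sg_conj_transpose S neg T X =
     mat (dim_col X) (dim_row X) (\<lambda>(i, j). sg_conj S neg T (X $$ (j, i)))"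

text \<open>
  Adjoining commuting variables to the real signed group ring gives the signed group ring with
  coefficients in the real polynomials in these variables.
\<close>

type_synonym real_mpoly = "(nat \<Rightarrow>\<^sub>0 nat) \<Rightarrow>\<^sub>0 real"

definition var :: "nat \<Rightarrow> real_mpoly" where
  "var i = Poly_Mapping.single (Poly_Mapping.single i 1) 1"

definition is_SOD ::
  "('a, 'b) monoid_scheme \<Rightarrow> 'a \<Rightarrow> 'a set \<Rightarrow> nat \<Rightarrow> nat list \<Rightarrow> ('a \<Rightarrow> real_mpoly) mat \<Rightarrow> bool" where
  "is_SOD S neg T n us X \<longleftrightarrow>
     X \<in> carrier_mat n n \<and>
     (\<forall>u\<in>set us. 0 < u) \<and>
     (\<forall>i<n. \<forall>j<n. X $$ (i, j) = \<zero>\<^bsub>signed_group_ring S neg T\<^esub> \<or>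
        (\<exists>e\<in>carrier S. \<exists>v<length us. X $$ (i, j) = sg_term S neg T e (var v))) \<and>
     mat_mult_over (signed_group_ring S neg T) X (sg_conj_transpose S neg T X) =
       mat n n (\<lambda>(i, j).
         if i = j then sg_term S neg T \<one>\<^bsub>S\<^esub> (\<Sum>v<length us. of_nat (us ! v) * (var v)\<^sup>2)
         else \<zero>\<^bsub>signed_group_ring S neg T\<^esub>)"

definition SP :: "nat \<Rightarrow> real mat monoid" where
  "SP m =
     \<lparr>carrier = {A \<in> carrier_mat m m.
        (\<forall>i<m. \<forall>j<m. A $$ (i, j) \<in> {0, 1, -1}) \<and>
        (\<forall>i<m. \<exists>!j. j < m \<and> A $$ (i, j) \<noteq> 0) \<and>
        (\<forall>j<m. \<exists>!i. i < m \<and> A $$ (i, j) \<noteq> 0)},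
      monoid.mult = (*),
      one = 1\<^sub>m m\<rparr>"

definition remrep :: "('a, 'b) monoid_scheme \<Rightarrow> 'a \<Rightarrow> nat \<Rightarrow> ('a \<Rightarrow> real mat) \<Rightarrow> bool" where
  "remrep S neg m \<phi> \<longleftrightarrow> \<phi> \<in> hom S (SP m) \<and> \<phi> neg = - (1\<^sub>m m)"

end

theory Submission
  imports Defs "HOL-Algebra.Weak_Morphisms" "HOL-Library.Countable"
begin

text \<open>
  Put \<open>k = 2 ^ (n - 1) - 1\<close>. The signed group is the Heisenberg group over the field with two
  elements: products of a sign, a translation of \<open>F\<^sub>2\<^sup>k\<close> and a character of \<open>F\<^sub>2\<^sup>k\<close>, acting by
  signed permutations on the \<open>2 ^ k\<close> points. It contains the unit \<open>E 0\<close> and \<open>2 k + 1\<close> pairwise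
  anticommuting elements \<open>E a\<close>, where \<open>0 < a < 2 ^ n\<close>: the \<open>k\<close> ones with \<open>a\<close> even square to
  \<open>-1\<close>, the \<open>k + 1\<close> ones with \<open>a\<close> odd square to \<open>1\<close>. The matrix with entries
  \<open>E (i XOR j) x\<^bsub>i XOR j\<^esub>\<close> has inner products of rows in which the summands \<open>l\<close> and \<open>i XOR j XOR l\<close>
  involve the same two variables; they cancel when the indices \<open>a\<close> and \<open>b\<close> of these variables have
  the same parity and agree otherwise. Changing the sign of the entries in which \<open>i\<close> and \<open>i XOR j\<close>
  are both odd repairs the second case without affecting the first.
\<close>

section \<open>Exclusive or on natural numbers; elements of order two\<close>

unbundle bit_operations_syntax

lemma xor_self_left_nat [simp]: "a XOR (a XOR b) = b" for a b :: nat
  by (simp flip: xor.assoc)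

lemma xor_less_exp: "a < 2 ^ k \<Longrightarrow> b < 2 ^ k \<Longrightarrow> a XOR b < 2 ^ k" for a b :: nat
  by (metis take_bit_nat_eq_self_iff take_bit_xor)

lemma (in group) ord_eq_2_iff:
  assumes "x \<in> carrier G"
  shows "ord x = 2 \<longleftrightarrow> x \<noteq> \<one> \<and> x \<otimes> x = \<one>"
proof
  assume "ord x = 2"
  then show "x \<noteq> \<one> \<and> x \<otimes> x = \<one>"
    using pow_ord_eq_1[OF assms] assms by (auto simp: numeral_2_eq_2)
next
  assume "x \<noteq> \<one> \<and> x \<otimes> x = \<one>"
  then have "ord x dvd 2" "ord x \<noteq> 1"
    using assms pow_eq_id[of x 2] ord_eq_1 by (auto simp: numeral_2_eq_2)
  moreover have "ord x \<le> 2"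
    using \<open>ord x dvd 2\<close> by (rule dvd_imp_le) simp
  moreover have "ord x \<noteq> 0"
    using \<open>ord x dvd 2\<close> by (metis dvd_0_left_iff zero_neq_numeral)
  ultimately show "ord x = 2" by linarith
qed

section \<open>Arithmetic with the distinguished element; existence of a transversal\<close>

context signed_group
begin

lemma neg_neg: "neg \<otimes> neg = \<one>" and neg_neq_one: "neg \<noteq> \<one>"
  using ord_eq_2_iff[OF neg_closed] neg_order by auto

lemma neg_mult_neg: "s \<in> carrier S \<Longrightarrow> neg \<otimes> (neg \<otimes> s) = s"
  by (metis l_one m_assoc neg_closed neg_neg)

lemma neg_mult_neq: "s \<in> carrier S \<Longrightarrow> neg \<otimes> s \<noteq> s"
  using neg_closed neg_neq_one r_cancel_one by auto

lemma mult_neg_right: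
  "\<lbrakk>s \<in> carrier S; t \<in> carrier S\<rbrakk> \<Longrightarrow> s \<otimes> (neg \<otimes> t) = neg \<otimes> (s \<otimes> t)"
  by (metis m_assoc neg_central neg_closed)

lemma inv_neg_mult:
  assumes "s \<in> carrier S"
  shows "inv (neg \<otimes> s) = neg \<otimes> inv s"
proof -
  have "inv neg = neg"
    by (simp add: inv_equality neg_closed neg_neg)
  then show ?thesis
    using assms by (simp add: inv_mult_group neg_closed neg_central)
qed

end

lemma (in group) signed_groupI:
  assumes "neg \<in> carrier G" "neg \<noteq> \<one>" "neg \<otimes> neg = \<one>"
    and "\<And>s. s \<in> carrier G \<Longrightarrow> neg \<otimes> s = s \<otimes> neg"
  shows "signed_group G neg"
proof
  show "ord neg = 2"
    using assms(1-3) ord_eq_2_iff by simp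
qed (fact assms)+

text \<open>The pair of \<open>s\<close> and \<open>neg \<otimes> s\<close> has two distinct
  members, so a linear order on the elements selects the smaller one.\<close>

lemma transversal_less:
  fixes S :: "('a::linorder, 'b) monoid_scheme" (structure)
  assumes "signed_group S neg"
  shows "transversal S neg {s \<in> carrier S. s < neg \<otimes> s}"
proof -
  interpret signed_group S neg by fact
  show ?thesis
    unfolding transversal_def
  proof (intro conjI ballI)
    fix s assume s: "s \<in> carrier S"
    then have *: "neg \<otimes> s \<in> carrier S" "neg \<otimes> (neg \<otimes> s) = s"
      by (simp_all add: neg_closed neg_mult_neg)
    consider "s < neg \<otimes> s" | "neg \<otimes> s < s"
      using neg_mult_neq[OF s] by fastforce
    then show "\<exists>!t. t \<in> {s \<in> carrier S. s < neg \<otimes> s} \<and> t \<in> {s, neg \<otimes> s}"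
    proof cases
      case 1
      then show ?thesis using s * by (intro ex1I[of _ s]) auto
    next
      case 2
      then show ?thesis using s * by (intro ex1I[of _ "neg \<otimes> s"]) auto
    qed
  qed auto
qed

section \<open>Single terms in the signed group ring, and designs indexed by XOR\<close>

locale signed_group_transversal = signed_group +
  fixes T
  assumes transv: "transversal S neg T"
begin

abbreviation sgt :: "'a \<Rightarrow> 'r::comm_ring_1 \<Rightarrow> 'a \<Rightarrow> 'r" where
  "sgt \<equiv> sg_term S neg T"

abbreviation sgr :: "('a \<Rightarrow> 'r::comm_ring_1) ring" where
  "sgr \<equiv> signed_group_ring S neg T"

lemma neg_mult_in_transversal:
  assumes "s \<in> carrier S"
  shows "neg \<otimes> s \<in> T \<longleftrightarrow> s \<notin> T"
proof -
  have "\<exists>!t. t \<in> T \<and> t \<in> {s, neg \<otimes> s}"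
    using transv assms by (simp add: transversal_def)
  then show ?thesis
    using neg_mult_neq[OF assms] by auto
qed

lemma sg_term_neg:
  assumes "s \<in> carrier S"
  shows "sgt (neg \<otimes> s) r = sgt s (- r)"
  using neg_mult_in_transversal[OF assms] neg_mult_neg[OF assms]
  by (auto simp: sg_term_def fun_eq_iff)

lemma sg_term_0: "sgt s 0 = (\<lambda>_. 0)"
  by (auto simp: sg_term_def)

lemma sg_term_add: "sgt s (p + q) t = sgt s p t + sgt s q t"
  by (auto simp: sg_term_def)

lemma sg_term_uminus: "sgt s (- p) t = - sgt s p t"
  by (auto simp: sg_term_def)

lemma sg_term_sum: "(\<Sum>i\<in>A. sgt s (p i) t) = sgt s (sum p A) t"
  by (induction A rule: infinite_finite_induct) (simp_all add: sg_term_0 sg_term_add)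

text \<open>Normal form: every term lives on one point of \<open>T\<close>, at the price of a sign
  \<open>c\<close>. Products and conjugates of terms are computed from it.\<close>

lemma sg_term_cases:
  fixes r :: "'r::comm_ring_1"
  assumes "s \<in> carrier S"
  obtains t c where "t \<in> T" "t \<in> carrier S"
    "sgt s r = (\<lambda>x. if x = t then c * r else 0)"
    "t = s \<and> c = 1 \<or> t = neg \<otimes> s \<and> c = -1"
proof (cases "s \<in> T")
  case True
  then show ?thesis
    using assms by (intro that[of s 1]) (auto simp: sg_term_def)
next
  case False
  then show ?thesis
    using assms neg_mult_in_transversal[OF assms] neg_closed
    by (intro that[of "neg \<otimes> s" "-1"]) (auto simp: sg_term_def)
qed

lemma sg_term_in_carrier:
  assumes "s \<in> carrier S"
  shows "sgt s r \<in> carrier sgr"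
proof -
  obtain t c where t: "t \<in> T" "sgt s r = (\<lambda>x. if x = t then c * r else 0)"
    using sg_term_cases[OF assms] by metis
  then have "{x. sgt s r x \<noteq> 0} \<subseteq> {t}" by auto
  then show ?thesis
    using t(1) finite_subset[of _ "{t}"] by (auto simp: signed_group_ring_def)
qed

lemma sg_term_mult:
  fixes p q :: "'r::comm_ring_1"
  assumes "a \<in> carrier S" "b \<in> carrier S"
  shows "sgt a p \<otimes>\<^bsub>sgr\<^esub> sgt b q = sgt (a \<otimes> b) (p * q)"
\<comment> \<open>The ring product sums over supports, which are singletons only for nonzero
  coefficients.\<close>
proof (cases "p = 0 \<or> q = 0")
  case True
  then show ?thesis
    by (auto simp: signed_group_ring_def sg_term_0)
next
  case False
  obtain a' and c :: 'r where a': "a' \<in> T" "a' \<in> carrier S"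
      "sgt a p = (\<lambda>x. if x = a' then c * p else 0)"
      "a' = a \<and> c = 1 \<or> a' = neg \<otimes> a \<and> c = -1"
    by (rule sg_term_cases[OF assms(1)])
  obtain b' and d :: 'r where b': "b' \<in> T" "b' \<in> carrier S"
      "sgt b q = (\<lambda>x. if x = b' then d * q else 0)"
      "b' = b \<and> d = 1 \<or> b' = neg \<otimes> b \<and> d = -1"
    by (rule sg_term_cases[OF assms(2)])
  have "{x. sgt a p x \<noteq> 0} = {a'}" "{x. sgt b q x \<noteq> 0} = {b'}"
    using False a'(4) b'(4) by (auto simp: a'(3) b'(3))
  then have "sgt a p \<otimes>\<^bsub>sgr\<^esub> sgt b q = sgt (a' \<otimes> b') ((c * p) * (d * q))"
    by (simp add: signed_group_ring_def a'(3) b'(3))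
  also have "\<dots> = sgt (a \<otimes> b) (p * q)"
  proof -
    have "(neg \<otimes> a) \<otimes> b = neg \<otimes> (a \<otimes> b)" "a \<otimes> (neg \<otimes> b) = neg \<otimes> (a \<otimes> b)"
      using assms m_assoc[OF neg_closed] mult_neg_right by auto
    moreover have "(neg \<otimes> a) \<otimes> (neg \<otimes> b) = a \<otimes> b"
      using assms by (metis calculation(1) m_closed mult_neg_right neg_closed neg_mult_neg)
    ultimately show ?thesis
      using a'(4) b'(4) assms by (auto simp: sg_term_neg)
  qed
  finally show ?thesis .
qed

lemma sg_conj_sg_term:
  fixes p :: "'r::comm_ring_1"
  assumes "a \<in> carrier S"
  shows "sg_conj S neg T (sgt a p) = sgt (inv a) p"
proof (cases "p = 0")
  case True
  then show ?thesis
    by (auto simp: sg_conj_def sg_term_0)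
next
  case False
  obtain a' and c :: 'r where a': "a' \<in> T" "a' \<in> carrier S"
      "sgt a p = (\<lambda>x. if x = a' then c * p else 0)"
      "a' = a \<and> c = 1 \<or> a' = neg \<otimes> a \<and> c = -1"
    by (rule sg_term_cases[OF assms])
  have "{x. sgt a p x \<noteq> 0} = {a'}"
    using False a'(4) by (auto simp: a'(3))
  then have "sg_conj S neg T (sgt a p) = sgt (inv a') (c * p)"
    by (simp add: sg_conj_def a'(3))
  also have "\<dots> = sgt (inv a) p"
    using a'(4) assms by (auto simp: inv_neg_mult sg_term_neg)
  finally show ?thesis .
qed

lemma abelian_monoid_sgr: "abelian_monoid (sgr :: ('a \<Rightarrow> 'r::comm_ring_1) ring)"
proof (rule abelian_monoidI)
  fix f g :: "'a \<Rightarrow> 'r"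
  assume "f \<in> carrier sgr" "g \<in> carrier sgr"
  moreover have "{x. f x + g x \<noteq> 0} \<subseteq> {x. f x \<noteq> 0} \<union> {x. g x \<noteq> 0}" by auto
  ultimately show "f \<oplus>\<^bsub>sgr\<^esub> g \<in> carrier sgr"
    by (auto simp: signed_group_ring_def elim: finite_subset)
qed (auto simp: signed_group_ring_def add_ac)

lemma finsum_sgr:
  fixes f :: "'i \<Rightarrow> 'a \<Rightarrow> 'r::comm_ring_1"
  assumes "finite A" "f \<in> A \<rightarrow> carrier sgr"
  shows "finsum sgr f A = (\<lambda>t. \<Sum>i\<in>A. f i t)"
proof -
  interpret R: abelian_monoid "sgr :: ('a \<Rightarrow> 'r) ring"
    by (rule abelian_monoid_sgr)
  show ?thesis
    using assms
  proof (induction A)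
    case empty
    show ?case by (simp only: R.finsum_empty) (simp add: signed_group_ring_def)
  next
    case (insert x F)
    then have "finsum sgr f (insert x F) = f x \<oplus>\<^bsub>sgr\<^esub> finsum sgr f F"
      by (intro R.finsum_insert) auto
    also have "\<dots> = (\<lambda>t. \<Sum>i\<in>insert x F. f i t)"
      using insert by (simp add: signed_group_ring_def)
    finally show ?case .
  qed
qed

text \<open>In the product of rows \<open>i\<close> and \<open>j\<close>, the columns
  \<open>l\<close> and \<open>i XOR j XOR l\<close> carry the same two variables in swapped order.
  By \<open>anti\<close> their group parts are opposite, so the sum over all columns
  vanishes.\<close>

lemma is_SOD_xor:
  fixes e :: "nat \<Rightarrow> nat \<Rightarrow> 'a"
  assumes e: "\<And>i j. \<lbrakk>i < 2 ^ n; j < 2 ^ n\<rbrakk> \<Longrightarrow> e i j \<in> carrier S"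
    and anti: "\<And>i j l. \<lbrakk>i < 2 ^ n; j < 2 ^ n; l < 2 ^ n; i \<noteq> j\<rbrakk> \<Longrightarrow>
      e i l \<otimes> inv (e j l) = neg \<otimes> (e i (i XOR j XOR l) \<otimes> inv (e j (i XOR j XOR l)))"
  shows "is_SOD S neg T (2 ^ n) (replicate (2 ^ n) 1)
    (mat (2 ^ n) (2 ^ n) (\<lambda>(i, j). sgt (e i j) (var (i XOR j))))"
    (is "is_SOD S neg T ?N _ ?X")
proof -
  have xor_bij: "bij_betw (\<lambda>l. a XOR l) {..<?N} {..<?N}" if "a < ?N" for a
    by (rule bij_betwI[of _ _ _ "\<lambda>l. a XOR l"])
      (use that xor_less_exp in auto)
  have entry: "(\<Oplus>\<^bsub>sgr\<^esub>l\<in>{..<?N}. ?X $$ (i, l) \<otimes>\<^bsub>sgr\<^esub>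
        sg_conj_transpose S neg T ?X $$ (l, j)) =
      (if i = j then sgt \<one> (\<Sum>v<?N. (var v)\<^sup>2) else \<zero>\<^bsub>sgr\<^esub>)"
    if ij: "i < ?N" "j < ?N" for i j
  proof -
    let ?g = "\<lambda>l. sgt (e i l \<otimes> inv (e j l)) (var (i XOR l) * var (j XOR l))"
    have "(\<Oplus>\<^bsub>sgr\<^esub>l\<in>{..<?N}. ?X $$ (i, l) \<otimes>\<^bsub>sgr\<^esub>
        sg_conj_transpose S neg T ?X $$ (l, j)) = (\<Oplus>\<^bsub>sgr\<^esub>l\<in>{..<?N}. ?g l)"
      by (intro abelian_monoid.finsum_cong' abelian_monoid_sgr)
        (use ij e in \<open>auto simp: sg_conj_transpose_def sg_conj_sg_term sg_term_mult sg_term_in_carrier\<close>)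
    also have "\<dots> = (\<lambda>t. \<Sum>l<?N. ?g l t)"
      using ij e by (intro finsum_sgr) (auto intro!: sg_term_in_carrier)
    also have "\<dots> = (if i = j then sgt \<one> (\<Sum>v<?N. (var v)\<^sup>2) else \<zero>\<^bsub>sgr\<^esub>)"
    proof (cases "i = j")
      case True
      have "(\<Sum>l<?N. ?g l t) = sgt \<one> (\<Sum>v<?N. (var v)\<^sup>2) t" for t
      proof -
        \<comment> \<open>On the diagonal \<open>e i l\<close> meets its own inverse, and
          \<open>l\<close> to \<open>i XOR l\<close> permutes the variables.\<close>
        have "(\<Sum>l<?N. ?g l t) = (\<Sum>l<?N. sgt \<one> ((var (i XOR l))\<^sup>2) t)"
          using True ij e by (intro sum.cong) (auto simp: power2_eq_square)
        also have "\<dots> = sgt \<one> (\<Sum>l<?N. (var (i XOR l))\<^sup>2) t"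
          by (rule sg_term_sum)
        also have "(\<Sum>l<?N. (var (i XOR l))\<^sup>2) = (\<Sum>v<?N. (var v)\<^sup>2)"
          by (rule sum.reindex_bij_betw[OF xor_bij[OF ij(1)]])
        finally show ?thesis .
      qed
      with True show ?thesis by (simp add: fun_eq_iff)
    next
      case False
      have "(\<Sum>l<?N. ?g l t) = 0" for t
      proof -
        have "(\<Sum>l<?N. ?g l t) = (\<Sum>l<?N. ?g (i XOR j XOR l) t)"
          using sum.reindex_bij_betw[OF xor_bij[OF xor_less_exp[OF ij]], of "\<lambda>l. ?g l t"]
          by (simp add: xor.assoc)
        also have "\<dots> = (\<Sum>l<?N. - ?g l t)"
        proof (rule sum.cong)
          fix l assume "l \<in> {..<?N}"
          then have l: "l < ?N" "i XOR j XOR l < ?N"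
            using ij by (simp_all add: xor_less_exp)
          have "i XOR (i XOR j XOR l) = j XOR l" "j XOR (i XOR j XOR l) = i XOR l"
            by (auto intro!: bit_eqI simp: bit_xor_iff)
          moreover have "?g l = sgt (e i (i XOR j XOR l) \<otimes> inv (e j (i XOR j XOR l)))
              (- (var (i XOR l) * var (j XOR l)))"
            using anti[OF ij l(1) False] ij l e by (simp add: sg_term_neg)
          ultimately show "?g (i XOR j XOR l) t = - ?g l t"
            by (simp add: sg_term_uminus mult.commute)
        qed simp
        \<comment> \<open>The sum equals its own negative, and 2 can be cancelled in real
          polynomials.\<close>
        finally have "2 * (\<Sum>l<?N. ?g l t) = 0"
          unfolding sum_negf eq_neg_iff_add_eq_0 mult_2 .
        then show ?thesis by simp
      qed
      with False show ?thesis by (simp add: signed_group_ring_def)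
    qed
    finally show ?thesis .
  qed
  show ?thesis
    unfolding is_SOD_def
  proof (intro conjI allI impI)
    fix i j assume "i < ?N" "j < ?N"
    then show "?X $$ (i, j) = \<zero>\<^bsub>sgr\<^esub> \<or>
        (\<exists>s\<in>carrier S. \<exists>v<length (replicate ?N 1). ?X $$ (i, j) = sgt s (var v))"
      using e xor_less_exp by (intro disjI2 bexI[of _ "e i j"] exI[of _ "i XOR j"]) auto
  next
    show "mat_mult_over sgr ?X (sg_conj_transpose S neg T ?X) = mat ?N ?N (\<lambda>(i, j).
         if i = j then sgt \<one> (\<Sum>v<length (replicate ?N 1). of_nat (replicate ?N 1 ! v) * (var v)\<^sup>2)
         else \<zero>\<^bsub>sgr\<^esub>)"
      by (rule eq_matI) (use entry in \<open>simp_all add: mat_mult_over_def sg_conj_transpose_def\<close>)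
  qed auto
qed

end

section \<open>Transport of signed groups and remreps along an injection\<close>

lemma (in group) group_hom_image_group:
  assumes "inj_on h (carrier G)"
  shows "group_hom G (image_group h G) h"
\<comment> \<open>A weak morphism modulo \<open>H\<close> identifies exactly the elements in one
  coset of \<open>H\<close>; injectivity is the case of the trivial subgroup.\<close>
proof (rule weak_group_morphism_group_hom[where H = "{\<one>}"], rule weak_group_morphismsI)
  show "{\<one>} \<lhd> G" by (rule one_is_normal)
next
  fix a b assume "a \<in> carrier G" "b \<in> carrier G"
  then show "h a = h b \<longleftrightarrow> a \<otimes> inv b \<in> {\<one>}"
    using assms by (metis inj_onD inv_equality inv_inv inv_closed r_inv singleton_iff)
qed

lemma (in signed_group) signed_group_image_group:
  assumes "inj_on h (carrier S)"
  shows "signed_group (image_group h S) (h neg)"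
proof -
  interpret h: group_hom S "image_group h S" h
    by (rule group_hom_image_group[OF assms])
  show ?thesis
  proof (rule h.H.signed_groupI)
    show "h neg \<noteq> \<one>\<^bsub>image_group h S\<^esub>"
      using assms neg_closed neg_neq_one by (metis h.hom_one inj_onD one_closed)
    show "h neg \<otimes>\<^bsub>image_group h S\<^esub> h neg = \<one>\<^bsub>image_group h S\<^esub>"
      using h.hom_mult[OF neg_closed neg_closed] by (simp add: neg_neg)
    fix s assume "s \<in> carrier (image_group h S)"
    then obtain g where "g \<in> carrier S" "s = h g"
      by (auto simp: image_group_carrier)
    then show "h neg \<otimes>\<^bsub>image_group h S\<^esub> s = s \<otimes>\<^bsub>image_group h S\<^esub> h neg"
      by (metis h.hom_mult neg_central neg_closed)
  qed (simp add: neg_closed)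
qed

lemma remrep_image_group:
  assumes "group G" "remrep G neg m \<phi>" "neg \<in> carrier G" "inj_on h (carrier G)"
  shows "remrep (image_group h G) (h neg) m (\<phi> \<circ> inv_into (carrier G) h)"
proof -
  interpret group G by fact
  show ?thesis
    using assms(2-4) by (auto simp: remrep_def hom_def image_group_def Pi_def)
qed

section \<open>The Heisenberg group over the field with two elements\<close>

definition dot_sign :: "nat \<Rightarrow> nat \<Rightarrow> nat \<Rightarrow> int" where
  "dot_sign k w v = (\<Prod>b<k. if bit w b \<and> bit v b then - 1 else 1)"

text \<open>\<open>dot_sign\<close> is -1 to the power of the inner product of the lowest
  \<open>k\<close> bits, which is additive under XOR modulo 2.\<close>

lemma dot_sign_xor_right: "dot_sign k w (u XOR v) = dot_sign k w u * dot_sign k w v"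
  unfolding dot_sign_def prod.distrib[symmetric] by (rule prod.cong) (auto simp: bit_xor_iff)

lemma dot_sign_xor_left: "dot_sign k (u XOR v) w = dot_sign k u w * dot_sign k v w"
  unfolding dot_sign_def prod.distrib[symmetric] by (rule prod.cong) (auto simp: bit_xor_iff)

lemma dot_sign_0 [simp]: "dot_sign k w 0 = 1" "dot_sign k 0 w = 1"
  by (simp_all add: dot_sign_def)

lemma dot_sign_square [simp]: "dot_sign k w v * dot_sign k w v = 1"
  by (simp flip: dot_sign_xor_right)

lemma dot_sign_cases: "dot_sign k w v = 1 \<or> dot_sign k w v = - 1"
  using dot_sign_square square_eq_1_iff by blast

text \<open>The triple \<open>(v, w, s)\<close> stands for the sign \<open>s\<close> times the
  translation by \<open>v\<close> after the character \<open>w\<close>. Moving \<open>w\<close> past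
  \<open>v'\<close> produces the factor \<open>dot_sign k w v'\<close>.\<close>

definition heis :: "nat \<Rightarrow> (nat \<times> nat \<times> int) monoid" where
  "heis k = \<lparr>carrier = {..<2 ^ k} \<times> {..<2 ^ k} \<times> {1, - 1},
     monoid.mult = (\<lambda>(v, w, s) (v', w', s'). (v XOR v', w XOR w', s * s' * dot_sign k w v')),
     one = (0, 0, 1)\<rparr>"

lemma heis_carrier:
  "(v, w, s) \<in> carrier (heis k) \<longleftrightarrow> v < 2 ^ k \<and> w < 2 ^ k \<and> (s = 1 \<or> s = - 1)"
  by (simp add: heis_def)

lemma heis_mult:
  "(v, w, s) \<otimes>\<^bsub>heis k\<^esub> (v', w', s') = (v XOR v', w XOR w', s * s' * dot_sign k w v')"
  by (simp add: heis_def)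

lemma heis_one: "\<one>\<^bsub>heis k\<^esub> = (0, 0, 1)"
  by (simp add: heis_def)

lemma group_heis: "group (heis k)"
proof (rule groupI)
  fix x assume x: "x \<in> carrier (heis k)"
  obtain v w s where [simp]: "x = (v, w, s)" by (cases x)
  have "(v, w, s * dot_sign k w v) \<in> carrier (heis k)"
    using x dot_sign_cases[of k w v] by (auto simp: heis_carrier)
  moreover have "(v, w, s * dot_sign k w v) \<otimes>\<^bsub>heis k\<^esub> x = \<one>\<^bsub>heis k\<^esub>"
    using x dot_sign_cases[of k w v] by (auto simp: heis_carrier heis_mult heis_one)
  ultimately show "\<exists>y\<in>carrier (heis k). y \<otimes>\<^bsub>heis k\<^esub> x = \<one>\<^bsub>heis k\<^esub>" by blast
next
  fix x y assume x: "x \<in> carrier (heis k)" and y: "y \<in> carrier (heis k)"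
  obtain v w s v' w' s' where [simp]: "x = (v, w, s)" "y = (v', w', s')"
    by (cases x, cases y)
  show "x \<otimes>\<^bsub>heis k\<^esub> y \<in> carrier (heis k)"
    using x y dot_sign_cases[of k w v'] by (auto simp: heis_carrier heis_mult xor_less_exp)
qed (auto simp: heis_mult heis_carrier heis_one dot_sign_xor_left dot_sign_xor_right xor.assoc)

text \<open>The square of \<open>(v, w, s)\<close> is the central sign
  \<open>dot_sign k w v\<close>, so the inverse is the element times that sign.\<close>

lemma inv_heis:
  assumes "(v, w, s) \<in> carrier (heis k)"
  shows "inv\<^bsub>heis k\<^esub> (v, w, s) = (v, w, s * dot_sign k w v)"
  by (rule group.inv_equality[OF group_heis])
    (use assms dot_sign_cases[of k w v] in \<open>auto simp: heis_carrier heis_mult heis_one\<close>)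

lemma signed_group_heis: "signed_group (heis k) (0, 0, - 1)"
  by (rule group.signed_groupI[OF group_heis]) (auto simp: heis_carrier heis_mult heis_one)

section \<open>The monomial representation on the \<open>2 ^ k\<close> points\<close>

definition heis_rep :: "nat \<Rightarrow> nat \<times> nat \<times> int \<Rightarrow> real mat" where
  "heis_rep k = (\<lambda>(v, w, s). mat (2 ^ k) (2 ^ k)
     (\<lambda>(i, j). if i = v XOR j then of_int (s * dot_sign k w j) else 0))"

lemma xor_eq_swap: "i = v XOR j \<longleftrightarrow> j = v XOR i" for i j v :: nat
  by auto

lemma heis_rep_in_SP:
  assumes "x \<in> carrier (heis k)"
  shows "heis_rep k x \<in> carrier (SP (2 ^ k))"
proof -
  obtain v w s where x: "x = (v, w, s)" by (cases x)
  have v: "v < 2 ^ k" and s: "s = 1 \<or> s = - 1"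
    using assms by (auto simp: x heis_carrier)
  \<comment> \<open>The support is the graph of the translation by \<open>v\<close>, a permutation,
    hence one nonzero entry per row and column.\<close>
  have nz: "heis_rep k x $$ (i, j) \<noteq> 0 \<longleftrightarrow> i = v XOR j" if "i < 2 ^ k" "j < 2 ^ k" for i j
    using that s dot_sign_cases[of k w j] by (auto simp: heis_rep_def x)
  have "heis_rep k x $$ (i, j) \<in> {0, 1, - 1}" if "i < 2 ^ k" "j < 2 ^ k" for i j
    using that s dot_sign_cases[of k w j] by (auto simp: heis_rep_def x)
  moreover have "\<exists>!j. j < 2 ^ k \<and> heis_rep k x $$ (i, j) \<noteq> 0" if "i < 2 ^ k" for i
    using that v nz xor_eq_swap[of i v] by (intro ex1I[of _ "v XOR i"]) (auto simp: xor_less_exp)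
  moreover have "\<exists>!i. i < 2 ^ k \<and> heis_rep k x $$ (i, j) \<noteq> 0" if "j < 2 ^ k" for j
    using that v nz by (intro ex1I[of _ "v XOR j"]) (auto simp: xor_less_exp)
  moreover have "heis_rep k x \<in> carrier_mat (2 ^ k) (2 ^ k)"
    by (simp add: heis_rep_def x)
  ultimately show ?thesis
    by (simp add: SP_def)
qed

lemma heis_rep_mult:
  assumes "x \<in> carrier (heis k)" "y \<in> carrier (heis k)"
  shows "heis_rep k (x \<otimes>\<^bsub>heis k\<^esub> y) = heis_rep k x * heis_rep k y"
proof -
  obtain v w s v' w' s' where x: "x = (v, w, s)" and y: "y = (v', w', s')"
    by (cases x, cases y)
  have v': "v' < 2 ^ k"
    using assms by (auto simp: y heis_carrier)
  show ?thesis
  proof (rule eq_matI)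
    fix i j
    assume "i < dim_row (heis_rep k x * heis_rep k y)" "j < dim_col (heis_rep k x * heis_rep k y)"
    then have ij: "i < 2 ^ k" "j < 2 ^ k"
      by (simp_all add: heis_rep_def x y)
    then have "(heis_rep k x * heis_rep k y) $$ (i, j) =
        (\<Sum>l<2 ^ k. heis_rep k x $$ (i, l) * heis_rep k y $$ (l, j))"
      by (simp add: heis_rep_def x y scalar_prod_def atLeast0LessThan)
    \<comment> \<open>Column \<open>j\<close> of the second factor has its only nonzero entry in row
      \<open>v' XOR j\<close>.\<close>
    also have "\<dots> = (\<Sum>l<2 ^ k. if l = v' XOR j
        then heis_rep k x $$ (i, v' XOR j) * of_int (s' * dot_sign k w' j) else 0)"
      using ij by (intro sum.cong) (auto simp: heis_rep_def y)
    also have "\<dots> = heis_rep k x $$ (i, v' XOR j) * of_int (s' * dot_sign k w' j)"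
      using ij v' by (simp add: xor_less_exp)
    also have "\<dots> = heis_rep k (x \<otimes>\<^bsub>heis k\<^esub> y) $$ (i, j)"
      using ij v' by (simp add: heis_rep_def x y heis_mult xor_less_exp xor.assoc
          dot_sign_xor_left dot_sign_xor_right)
    finally show "heis_rep k (x \<otimes>\<^bsub>heis k\<^esub> y) $$ (i, j) = (heis_rep k x * heis_rep k y) $$ (i, j)" ..
  qed (simp_all add: heis_rep_def x y heis_mult)
qed

lemma remrep_heis: "remrep (heis k) (0, 0, - 1) (2 ^ k) (heis_rep k)"
  unfolding remrep_def
proof
  show "heis_rep k \<in> hom (heis k) (SP (2 ^ k))"
    using heis_rep_in_SP heis_rep_mult by (auto simp: hom_def SP_def)
  show "heis_rep k (0, 0, - 1) = - 1\<^sub>m (2 ^ k)"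
    by (rule eq_matI) (auto simp: heis_rep_def)
qed

section \<open>The anticommuting family and the entries built from it\<close>

text \<open>
  The anticommuting family is the Jordan-Wigner one: with \<open>i = a div 2\<close>, the character of \<open>E a\<close> is
  supported on the bits below \<open>i\<close>, and its translation is the bit \<open>i\<close> if \<open>a\<close> is odd and the bit
  \<open>i - 1\<close> if \<open>a\<close> is even. The truncations in the two extreme cases are intended: they give the full
  character for \<open>i = k\<close> and \<open>a\<close> odd, and the unit for \<open>a = 0\<close>.
\<close>

definition shift_mask :: "nat \<Rightarrow> nat \<Rightarrow> nat" where
  "shift_mask k a = (if odd a then take_bit k (2 ^ (a div 2)) else 2 ^ (a div 2) div 2)"

text \<open>A power of two has a single bit, so at most one factor is -1; the bound
  \<open>m < k\<close> enters because \<open>dot_sign\<close> reads only the bits below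
  \<open>k\<close>.\<close>

lemma dot_sign_mask_exp:
  "dot_sign k (mask i) (2 ^ m) = (if m < i \<and> m < k then - 1 else 1)"
proof -
  have "dot_sign k (mask i) (2 ^ m) = (\<Prod>b<k. if b = m then (if m < i then - 1 else 1) else 1)"
    unfolding dot_sign_def by (rule prod.cong) (auto simp: bit_mask_iff bit_exp_iff)
  then show ?thesis by simp
qed

text \<open>The comparison with \<open>i\<close> is strict for odd and weak for even
  \<open>a\<close>. So for distinct positive indices exactly one of the two cross signs is -1, which
  is anticommutation; \<open>i = a div 2\<close> gives the square of \<open>E a\<close>.\<close>

lemma dot_sign_mask_shift_mask:
  assumes "i \<le> k" "a div 2 \<le> k"
  shows "dot_sign k (mask i) (shift_mask k a) =
    (if if odd a then a div 2 < i else 0 < a div 2 \<and> a div 2 \<le> i then - 1 else 1)"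
proof (cases "odd a")
  case True
  then show ?thesis
    using assms by (auto simp: shift_mask_def dot_sign_mask_exp take_bit_of_exp)
next
  case False
  show ?thesis
  proof (cases "a div 2")
    case 0
    with False show ?thesis by (simp add: shift_mask_def)
  next
    case (Suc m)
    with False assms show ?thesis by (auto simp: shift_mask_def dot_sign_mask_exp)
  qed
qed

text \<open>The first two components form \<open>E a\<close>; the last is the sign correction, with
  \<open>i\<close> the row and \<open>a\<close> the index of the variable.\<close>

definition heis_entry :: "nat \<Rightarrow> nat \<Rightarrow> nat \<Rightarrow> nat \<times> nat \<times> int" where
  "heis_entry k i a = (shift_mask k a, mask (a div 2), if odd i \<and> odd a then - 1 else 1)"

lemma heis_entry_carrier:
  assumes "a div 2 \<le> k"
  shows "heis_entry k i a \<in> carrier (heis k)"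
proof -
  have le: "2 ^ (a div 2) \<le> (2 ^ k :: nat)"
    using assms by (rule power_increasing) simp
  have "2 ^ (a div 2) div 2 < (2 ^ (a div 2) :: nat)"
    by (rule div_less_dividend) simp_all
  then have "2 ^ (a div 2) div 2 < (2 ^ k :: nat)"
    using le by (rule less_le_trans)
  moreover have "mask (a div 2) < (2 ^ (a div 2) :: nat)"
    by (simp add: mask_eq_exp_minus_1)
  then have "mask (a div 2) < (2 ^ k :: nat)"
    using le by (rule less_le_trans)
  ultimately show ?thesis
    by (simp add: heis_entry_def heis_carrier shift_mask_def)
qed

text \<open>For positive indices, anticommutation contributes -1 and replacing inverses contributes
  the product of both squares: 1 for equal parity, -1 otherwise. In the latter case exactly one side
  carries a correction sign. The unit \<open>E 0\<close> commutes but also squares to 1, unlike the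
  other even indices, and these two changes cancel.\<close>

lemma heis_entry_anti:
  assumes "a div 2 \<le> k" "b div 2 \<le> k" "a \<noteq> b" "odd i = odd j \<longleftrightarrow> odd a = odd b"
  shows "heis_entry k i a \<otimes>\<^bsub>heis k\<^esub> inv\<^bsub>heis k\<^esub> (heis_entry k j b) =
    (0, 0, - 1) \<otimes>\<^bsub>heis k\<^esub> (heis_entry k i b \<otimes>\<^bsub>heis k\<^esub> inv\<^bsub>heis k\<^esub> (heis_entry k j a))"
proof -
  \<comment> \<open>For equal parity the halves decide which cross sign is -1, so they must differ;
    for different parity the strict and weak comparisons settle even a tie.\<close>
  have "a div 2 \<noteq> b div 2" if "odd a = odd b"
    using that \<open>a \<noteq> b\<close> by presburger
  then show ?thesis
    using assms heis_entry_carrier[of a k j] heis_entry_carrier[of b k j]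
    by (auto simp: heis_entry_def inv_heis heis_mult dot_sign_mask_shift_mask xor.commute)
qed

section \<open>The design of order \<open>2 ^ n\<close> on a copy of the Heisenberg group\<close>

theorem theorem10:
  fixes n :: nat
  assumes "n > 2"
  shows "\<exists>(S :: nat monoid) neg T X \<phi>.
           signed_group S neg \<and>
           transversal S neg T \<and>
           is_SOD S neg T (2 ^ n) (replicate (2 ^ n) 1) X \<and>
           remrep S neg (2 ^ (2 ^ (n - 1) - 1)) \<phi>"
proof -
  define k :: nat where "k = 2 ^ (n - 1) - 1"
  \<comment> \<open>Encoding the triples as naturals gives a group on \<open>nat\<close>, whose
    order then yields \<open>T\<close>.\<close>
  define h :: "nat \<times> nat \<times> int \<Rightarrow> nat" where "h = to_nat"
  define S where "S = image_group h (heis k)"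
  define neg where "neg = h (0, 0, - 1)"
  define T where "T = {s \<in> carrier S. s < neg \<otimes>\<^bsub>S\<^esub> s}"
  define e where "e i j = h (heis_entry k i (i XOR j))" for i j
  have inj: "inj_on h (carrier (heis k))"
    by (simp add: h_def)
  interpret h: group_hom "heis k" S h
    unfolding S_def by (rule group.group_hom_image_group[OF group_heis inj])
  have sg: "signed_group S neg"
    unfolding S_def neg_def by (rule signed_group.signed_group_image_group[OF signed_group_heis inj])
  have T: "transversal S neg T"
    unfolding T_def by (rule transversal_less[OF sg])
  interpret signed_group_transversal S neg T
    using sg T by (simp add: signed_group_transversal_def signed_group_transversal_axioms_def)
  \<comment> \<open>This fixes the choice of \<open>k\<close>: the halves of indices below
    \<open>2 ^ n\<close> reach up to \<open>2 ^ (n - 1) - 1\<close>.\<close>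
  have half_le: "(i XOR j) div 2 \<le> k" if "i < 2 ^ n" "j < 2 ^ n" for i j
  proof -
    have "i XOR j < 2 * 2 ^ (n - 1)"
      using xor_less_exp[OF that] assms by (simp flip: power_Suc)
    then show ?thesis by (simp add: k_def)
  qed
  have "is_SOD S neg T (2 ^ n) (replicate (2 ^ n) 1)
      (mat (2 ^ n) (2 ^ n) (\<lambda>(i, j). sgt (e i j) (var (i XOR j))))"
  proof (rule is_SOD_xor)
    fix i j :: nat assume "i < 2 ^ n" "j < 2 ^ n"
    then show "e i j \<in> carrier S"
      unfolding e_def by (intro h.hom_closed heis_entry_carrier half_le)
  next
    fix i j l :: nat assume ij: "i < 2 ^ n" "j < 2 ^ n" "l < 2 ^ n" "i \<noteq> j"
    let ?a = "i XOR l" and ?b = "j XOR l"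
    have swap: "i XOR (i XOR j XOR l) = ?b" "j XOR (i XOR j XOR l) = ?a"
      by (simp_all add: xor.left_commute[of j i])
    have "?a \<noteq> ?b"
      using ij(4) by (metis xor.commute xor_self_left_nat)
    \<comment> \<open>Both indices contain the same \<open>l\<close>, whose parity cancels in the
      comparison.\<close>
    moreover have "odd i = odd j \<longleftrightarrow> odd ?a = odd ?b"
      by (auto simp: even_xor_iff)
    ultimately have "h (heis_entry k i ?a \<otimes>\<^bsub>heis k\<^esub> inv\<^bsub>heis k\<^esub> (heis_entry k j ?b)) =
      h ((0, 0, - 1) \<otimes>\<^bsub>heis k\<^esub> (heis_entry k i ?b \<otimes>\<^bsub>heis k\<^esub> inv\<^bsub>heis k\<^esub> (heis_entry k j ?a)))"
      using ij half_le by (intro arg_cong[of _ _ h] heis_entry_anti)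
    then show "e i l \<otimes>\<^bsub>S\<^esub> inv\<^bsub>S\<^esub> (e j l) =
        neg \<otimes>\<^bsub>S\<^esub> (e i (i XOR j XOR l) \<otimes>\<^bsub>S\<^esub> inv\<^bsub>S\<^esub> (e j (i XOR j XOR l)))"
      using ij by (simp add: e_def neg_def swap half_le heis_entry_carrier heis_carrier)
  qed
  moreover have "remrep S neg (2 ^ (2 ^ (n - 1) - 1)) (heis_rep k \<circ> inv_into (carrier (heis k)) h)"
    unfolding S_def neg_def using remrep_heis[of k] inj
    by (intro remrep_image_group group_heis) (simp_all add: heis_carrier k_def)
  ultimately show ?thesis
    using sg T by blast
qed

end
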